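(* Let $(F:\mathcal C\to\mathcal D,\ G:\mathcal D\to\mathcal C)$ be an adjoint pair of functors ($F$ left adjoint to $G$) with unit $\eta:1_{\mathcal C}\to GF$ and counit $\varepsilon:FG\to 1_{\mathcal D}$. Let $I:\mathcal C\to\mathcal X$ and $J:\mathcal D\to\mathcal Y$ be functors. Then: (1) The left adjoint $F$ is heavily $I$-separable if and only if there is a natural transformation $\gamma: IGF\to I$ such that $\gamma\circ I\eta=\mathrm{id}$ and $\gamma\circ(\gamma GF)=\gamma\circ(IG\varepsilon F)$. (2) The right adjoint $G$ is heavily $J$-separable if and only if there is a natural transformation $\delta: J\to JFG$ such that $J\varepsilon\circ\delta=\mathrm{id}$ and $(\delta FG)\circ\delta=(JF\eta G)\circ\delta$.
   Context: Definition (heavy $I$-separability). Let $F:\mathcal C\to\mathcal D$ and $I:\mathcal C\to\mathcal X$ be functors. $F$ is heavily $I$-separable if there is a natural transformation $P:\mathcal D(F(-),F(-))\to\mathcal X(I(-),I(-))$ of functors $\mathcal C^{op}\times\mathcal C\to \mathrm{Set}$ such that (a) $P_{a,b}(F(f))=I(f)$ for all $f\in\mathcal C(a,b)$ and all objects $a,b$ of $\mathcal C$; and (b) $P_{a,c}(g\circ f)=P_{b,c}(g)\circ P_{a,b}(f)$ for all objects $a,b,c$ of $\mathcal C$ and all $f\in\mathcal D(Fa,Fb)$, $g\in\mathcal D(Fb,Fc)$. Juxtaposition of functors and natural transformations denotes whiskering, e.g. $(\gamma GF)_a=\gamma_{GFa}$ and $(IG\varepsilon F)_a=IG(\varepsilon_{Fa})$.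 *)

theory Defs
  imports Main
begin

record ('o, 'm) category =
  Obj :: "'o set"
  Arr :: "'m set"
  Dom :: "'m \<Rightarrow> 'o"
  Cod :: "'m \<Rightarrow> 'o"
  Ident :: "'o \<Rightarrow> 'm"
  Comp :: "'m \<Rightarrow> 'm \<Rightarrow> 'm" (infixr \<open>\<cdot>\<index>\<close> 70)

definition Hom :: "('o, 'm) category \<Rightarrow> 'o \<Rightarrow> 'o \<Rightarrow> 'm set" where
  "Hom C a b = {f \<in> Arr C. Dom C f = a \<and> Cod C f = b}"

text \<open>Composition is written in the usual order: \<open>g \<cdot>\<^bsub>C\<^esub> f\<close> means first \<open>f\<close>, then \<open>g\<close>.
  It is only constrained on composable pairs.\<close>

locale category =
  fixes C :: "('o, 'm) category" (structure)
  assumes Dom_Obj: "f \<in> Arr C \<Longrightarrow> Dom C f \<in> Obj C"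
    and Cod_Obj: "f \<in> Arr C \<Longrightarrow> Cod C f \<in> Obj C"
    and Ident_Hom: "a \<in> Obj C \<Longrightarrow> Ident C a \<in> Hom C a a"
    and Comp_Hom: "f \<in> Hom C a b \<Longrightarrow> g \<in> Hom C b c \<Longrightarrow> g \<cdot> f \<in> Hom C a c"
    and Comp_Ident: "f \<in> Hom C a b \<Longrightarrow> f \<cdot> Ident C a = f"
    and Ident_Comp: "f \<in> Hom C a b \<Longrightarrow> Ident C b \<cdot> f = f"
    and Comp_assoc: "f \<in> Hom C a b \<Longrightarrow> g \<in> Hom C b c \<Longrightarrow> h \<in> Hom C c d \<Longrightarrow>
          (h \<cdot> g) \<cdot> f = h \<cdot> (g \<cdot> f)"

record ('o1, 'm1, 'o2, 'm2) fctor =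
  omap :: "'o1 \<Rightarrow> 'o2"
  amap :: "'m1 \<Rightarrow> 'm2"

locale is_functor = dom: category C + cod: category D
  for C :: "('o1, 'm1) category" and D :: "('o2, 'm2) category"
    and F :: "('o1, 'm1, 'o2, 'm2) fctor" +
  assumes omap_Obj: "a \<in> Obj C \<Longrightarrow> omap F a \<in> Obj D"
    and amap_Hom: "f \<in> Hom C a b \<Longrightarrow> amap F f \<in> Hom D (omap F a) (omap F b)"
    and amap_Ident: "a \<in> Obj C \<Longrightarrow> amap F (Ident C a) = Ident D (omap F a)"
    and amap_Comp: "f \<in> Hom C a b \<Longrightarrow> g \<in> Hom C b c \<Longrightarrow>
          amap F (g \<cdot>\<^bsub>C\<^esub> f) = amap F g \<cdot>\<^bsub>D\<^esub> amap F f"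

definition id_functor :: "('o, 'm, 'o, 'm) fctor" where
  "id_functor = \<lparr>omap = (\<lambda>a. a), amap = (\<lambda>f. f)\<rparr>"

definition comp_functor ::
  "('o2, 'm2, 'o3, 'm3) fctor \<Rightarrow> ('o1, 'm1, 'o2, 'm2) fctor \<Rightarrow> ('o1, 'm1, 'o3, 'm3) fctor"
  (infixr \<open>\<circ>\<^sub>F\<close> 75) where
  "G \<circ>\<^sub>F F = \<lparr>omap = omap G \<circ> omap F, amap = amap G \<circ> amap F\<rparr>"

locale nat_trans = source: is_functor C D F + target: is_functor C D G
  for C :: "('o1, 'm1) category" and D :: "('o2, 'm2) category"
    and F G :: "('o1, 'm1, 'o2, 'm2) fctor" and \<tau> :: "'o1 \<Rightarrow> 'm2" +
  assumes component_Hom: "a \<in> Obj C \<Longrightarrow> \<tau> a \<in> Hom D (omap F a) (omap G a)"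
    and naturality: "f \<in> Hom C a b \<Longrightarrow> \<tau> b \<cdot>\<^bsub>D\<^esub> amap F f = amap G f \<cdot>\<^bsub>D\<^esub> \<tau> a"

definition nt_id :: "('o2, 'm2) category \<Rightarrow> ('o1, 'm1, 'o2, 'm2) fctor \<Rightarrow> 'o1 \<Rightarrow> 'm2" where
  "nt_id D F = (\<lambda>a. Ident D (omap F a))"

definition nt_comp :: "('o2, 'm2) category \<Rightarrow> ('o1 \<Rightarrow> 'm2) \<Rightarrow> ('o1 \<Rightarrow> 'm2) \<Rightarrow> 'o1 \<Rightarrow> 'm2" where
  "nt_comp D \<sigma> \<tau> = (\<lambda>a. \<sigma> a \<cdot>\<^bsub>D\<^esub> \<tau> a)"

text \<open>Whiskering: \<open>K \<rhd> \<tau>\<close> has components \<open>K(\<tau>\<^sub>a)\<close>, and \<open>\<tau> \<lhd> H\<close> has components \<open>\<tau>\<close> at \<open>H a\<close>.\<close>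

definition whisker_left :: "('o2, 'm2, 'o3, 'm3) fctor \<Rightarrow> ('o1 \<Rightarrow> 'm2) \<Rightarrow> 'o1 \<Rightarrow> 'm3"
  (infixr \<open>\<rhd>\<close> 73) where
  "K \<rhd> \<tau> = (\<lambda>a. amap K (\<tau> a))"

definition whisker_right :: "('o2 \<Rightarrow> 'm3) \<Rightarrow> ('o1, 'm1, 'o2, 'm2) fctor \<Rightarrow> 'o1 \<Rightarrow> 'm3"
  (infixl \<open>\<lhd>\<close> 74) where
  "\<tau> \<lhd> H = (\<lambda>a. \<tau> (omap H a))"

text \<open>The value of a component family outside the objects of the source category carries no
  meaning, so two natural transformations are equal when they agree on all objects.\<close>

definition nt_eq :: "('o1, 'm1) category \<Rightarrow> ('o1 \<Rightarrow> 'm2) \<Rightarrow> ('o1 \<Rightarrow> 'm2) \<Rightarrow> bool" where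
  "nt_eq C \<sigma> \<tau> \<longleftrightarrow> (\<forall>a \<in> Obj C. \<sigma> a = \<tau> a)"

locale adjunction =
  left: is_functor C D F + right: is_functor D C G +
  unit: nat_trans C C id_functor "G \<circ>\<^sub>F F" \<eta> +
  counit: nat_trans D D "F \<circ>\<^sub>F G" id_functor \<epsilon>
  for C :: "('o1, 'm1) category" and D :: "('o2, 'm2) category"
    and F :: "('o1, 'm1, 'o2, 'm2) fctor" and G :: "('o2, 'm2, 'o1, 'm1) fctor"
    and \<eta> :: "'o1 \<Rightarrow> 'm1" and \<epsilon> :: "'o2 \<Rightarrow> 'm2" +
  assumes triangle_left: "nt_eq C (nt_comp D (\<epsilon> \<lhd> F) (F \<rhd> \<eta>)) (nt_id D F)"
    and triangle_right: "nt_eq D (nt_comp C (G \<rhd> \<epsilon>) (\<eta> \<lhd> G)) (nt_id C G)"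

text \<open>For \<open>u : a' \<rightarrow> a\<close> and \<open>v : b \<rightarrow> b'\<close> in \<open>D\<close>, \<open>hom_map D u v\<close> is the function
  \<open>D(u, v) : D(a, b) \<rightarrow> D(a', b')\<close>, i.e. the arrow part of the bifunctor \<open>D(-, -)\<close>.\<close>

definition hom_map :: "('o, 'm) category \<Rightarrow> 'm \<Rightarrow> 'm \<Rightarrow> 'm \<Rightarrow> 'm" where
  "hom_map D u v h = v \<cdot>\<^bsub>D\<^esub> (h \<cdot>\<^bsub>D\<^esub> u)"

text \<open>Natural transformations \<open>D(F(-), F(-)) \<rightarrow> X(I(-), I(-))\<close> of functors from
  \<open>C\<^sup>o\<^sup>p \<times> C\<close> to sets. A morphism \<open>(a, b) \<rightarrow> (a', b')\<close> of \<open>C\<^sup>o\<^sup>p \<times> C\<close> is a pair of arrows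
  \<open>u : a' \<rightarrow> a\<close> and \<open>v : b \<rightarrow> b'\<close> of \<open>C\<close>. The naturality squares are stated elementwise because
  the hom-sets of \<open>D\<close> and \<open>X\<close> are sets over different types.\<close>

locale hom_nat_trans = first: is_functor C D F + second: is_functor C X I
  for C :: "('o1, 'm1) category" and D :: "('o2, 'm2) category" and X :: "('o3, 'm3) category"
    and F :: "('o1, 'm1, 'o2, 'm2) fctor" and I :: "('o1, 'm1, 'o3, 'm3) fctor"
    and P :: "'o1 \<Rightarrow> 'o1 \<Rightarrow> 'm2 \<Rightarrow> 'm3" +
  assumes component_fun: "a \<in> Obj C \<Longrightarrow> b \<in> Obj C \<Longrightarrow> h \<in> Hom D (omap F a) (omap F b) \<Longrightarrow>
          P a b h \<in> Hom X (omap I a) (omap I b)"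
    and hom_naturality: "u \<in> Hom C a' a \<Longrightarrow> v \<in> Hom C b b' \<Longrightarrow>
          h \<in> Hom D (omap F a) (omap F b) \<Longrightarrow>
          P a' b' (hom_map D (amap F u) (amap F v) h)
            = hom_map X (amap I u) (amap I v) (P a b h)"

definition heavily_separable ::
  "('o1, 'm1) category \<Rightarrow> ('o2, 'm2) category \<Rightarrow> ('o3, 'm3) category \<Rightarrow>
   ('o1, 'm1, 'o2, 'm2) fctor \<Rightarrow> ('o1, 'm1, 'o3, 'm3) fctor \<Rightarrow> bool" where
  "heavily_separable C D X F I \<longleftrightarrow>
    (\<exists>P. hom_nat_trans C D X F I P \<and>
      (\<forall>a \<in> Obj C. \<forall>b \<in> Obj C. \<forall>f \<in> Hom C a b. P a b (amap F f) = amap I f) \<and>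
      (\<forall>a \<in> Obj C. \<forall>b \<in> Obj C. \<forall>c \<in> Obj C.
        \<forall>f \<in> Hom D (omap F a) (omap F b). \<forall>g \<in> Hom D (omap F b) (omap F c).
          P a c (g \<cdot>\<^bsub>D\<^esub> f) = P b c g \<cdot>\<^bsub>X\<^esub> P a b f))"

end

theory Submission
  imports Defs
begin

text \<open>For (1), the correspondence is of Yoneda type. A transformation \<open>P\<close> gives
  \<open>\<gamma>\<^sub>a = P(\<epsilon>\<^bsub>Fa\<^esub>)\<close>, and \<open>\<gamma>\<close> gives \<open>P\<^bsub>a,b\<^esub>(h) = \<gamma>\<^sub>b \<circ> IG(h) \<circ> I\<eta>\<^sub>a\<close>. Multiplicativity of \<open>P\<close>
  corresponds to the associativity condition on \<open>\<gamma>\<close> because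
  \<open>\<epsilon>\<^bsub>Fa\<^esub> \<circ> \<epsilon>\<^bsub>FGFa\<^esub> = \<epsilon>\<^bsub>Fa\<^esub> \<circ> FG\<epsilon>\<^bsub>Fa\<^esub>\<close>. Statement (2) is (1) for the adjunction between the
  opposite categories, in which \<open>G\<close> is the left adjoint.\<close>

section \<open>Typing and rewriting rules for categories, functors and natural
  transformations\<close>

context category
begin

lemma Ident_simps [simp]:
  assumes "a \<in> Obj C"
  shows "Ident C a \<in> Arr C" "Dom C (Ident C a) = a" "Cod C (Ident C a) = a"
  using Ident_Hom[OF assms] by (auto simp: Hom_def)

text \<open>The axioms type arrows by \<open>Hom\<close>, whose objects occur only in the premises
  and so cannot be found by rewriting. Here and below typing is split into \<open>Arr\<close>,
  \<open>Dom\<close> and \<open>Cod\<close>, so that the simplifier settles composability.\<close>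

lemma Comp_simps [simp]:
  assumes "f \<in> Arr C" "g \<in> Arr C" "Dom C g = Cod C f"
  shows "g \<cdot> f \<in> Arr C" "Dom C (g \<cdot> f) = Dom C f" "Cod C (g \<cdot> f) = Cod C g"
  using Comp_Hom[of f "Dom C f" "Cod C f" g "Cod C g"] assms by (auto simp: Hom_def)

lemma Comp_Ident_Arr [simp]:
  "f \<in> Arr C \<Longrightarrow> Dom C f = a \<Longrightarrow> f \<cdot> Ident C a = f"
  "f \<in> Arr C \<Longrightarrow> Cod C f = a \<Longrightarrow> Ident C a \<cdot> f = f"
  using Comp_Ident[of f a "Cod C f"] Ident_Comp[of f "Dom C f" a] by (auto simp: Hom_def)

lemma Comp_assoc_Arr [simp]:
  assumes "f \<in> Arr C" "g \<in> Arr C" "h \<in> Arr C" "Dom C g = Cod C f" "Dom C h = Cod C g"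
  shows "(h \<cdot> g) \<cdot> f = h \<cdot> (g \<cdot> f)"
  using Comp_assoc[of f "Dom C f" "Cod C f" g "Cod C g" h "Cod C h"] assms by (auto simp: Hom_def)

declare Dom_Obj [simp] Cod_Obj [simp]

text \<open>Since composites are normalised to the right, a square \<open>x \<cdot> y\<close>
  followed by further factors is no longer a subterm. This form applies the square in front of a
  remaining composite \<open>k\<close>.\<close>

lemma Comp_eq_extend:
  assumes "x \<cdot> y = z \<cdot> w"
    and "x \<in> Arr C" "y \<in> Arr C" "z \<in> Arr C" "w \<in> Arr C" "k \<in> Arr C"
    and "Dom C x = Cod C y" "Dom C z = Cod C w" "Dom C y = Cod C k" "Dom C w = Cod C k"
  shows "x \<cdot> (y \<cdot> k) = z \<cdot> (w \<cdot> k)"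
  using assms by (metis Comp_assoc_Arr)

end

context is_functor
begin

declare omap_Obj [simp] amap_Ident [simp]

lemma amap_simps [simp]:
  assumes "f \<in> Arr C"
  shows "amap F f \<in> Arr D" "Dom D (amap F f) = omap F (Dom C f)"
    "Cod D (amap F f) = omap F (Cod C f)"
  using amap_Hom[of f "Dom C f" "Cod C f"] assms by (auto simp: Hom_def)

lemma amap_Comp_Arr [simp]:
  assumes "f \<in> Arr C" "g \<in> Arr C" "Dom C g = Cod C f"
  shows "amap F (g \<cdot>\<^bsub>C\<^esub> f) = amap F g \<cdot>\<^bsub>D\<^esub> amap F f"
  using amap_Comp[of f "Dom C f" "Cod C f" g "Cod C g"] assms by (auto simp: Hom_def)

end

context nat_trans
begin

lemma component_simps [simp]:
  assumes "a \<in> Obj C"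
  shows "\<tau> a \<in> Arr D" "Dom D (\<tau> a) = omap F a" "Cod D (\<tau> a) = omap G a"
  using component_Hom[OF assms] by (auto simp: Hom_def)

lemma naturality_Arr:
  assumes "f \<in> Arr C"
  shows "\<tau> (Cod C f) \<cdot>\<^bsub>D\<^esub> amap F f = amap G f \<cdot>\<^bsub>D\<^esub> \<tau> (Dom C f)"
  using naturality[of f "Dom C f" "Cod C f"] assms by (auto simp: Hom_def)

end

lemma comp_functor_simps [simp]:
  "omap (G \<circ>\<^sub>F F) a = omap G (omap F a)"
  "amap (G \<circ>\<^sub>F F) f = amap G (amap F f)"
  by (simp_all add: comp_functor_def)

lemma id_functor_simps [simp]: "omap id_functor a = a" "amap id_functor f = f"
  by (simp_all add: id_functor_def)

lemma is_functor_comp: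
  assumes "is_functor C D F" "is_functor D E G"
  shows "is_functor C E (G \<circ>\<^sub>F F)"
proof -
  interpret F: is_functor C D F by fact
  interpret G: is_functor D E G by fact
  show ?thesis
    by unfold_locales (auto simp: Hom_def)
qed

lemmas nt_simps = nt_eq_def nt_comp_def nt_id_def whisker_left_def whisker_right_def

section \<open>Statement (1): heavy separability of the left adjoint\<close>

locale adjunction_with_functor = adjunction C D F G \<eta> \<epsilon> + test: is_functor C X I
  for C :: "('oc, 'mc) category" and D :: "('od, 'md) category"
    and F :: "('oc, 'mc, 'od, 'md) fctor" and G :: "('od, 'md, 'oc, 'mc) fctor"
    and \<eta> :: "'oc \<Rightarrow> 'mc" and \<epsilon> :: "'od \<Rightarrow> 'md"
    and X :: "('ox, 'mx) category" and I :: "('oc, 'mc, 'ox, 'mx) fctor"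
begin

lemma unit_simps [simp]:
  assumes "a \<in> Obj C"
  shows "\<eta> a \<in> Arr C" "Dom C (\<eta> a) = a" "Cod C (\<eta> a) = omap G (omap F a)"
  using unit.component_simps[OF assms] by simp_all

lemma counit_simps [simp]:
  assumes "x \<in> Obj D"
  shows "\<epsilon> x \<in> Arr D" "Dom D (\<epsilon> x) = omap F (omap G x)" "Cod D (\<epsilon> x) = x"
  using counit.component_simps[OF assms] by simp_all

lemma triangle_left_at: "a \<in> Obj C \<Longrightarrow> \<epsilon> (omap F a) \<cdot>\<^bsub>D\<^esub> amap F (\<eta> a) = Ident D (omap F a)"
  using triangle_left by (simp add: nt_simps)

lemma unit_natural:
  "f \<in> Arr C \<Longrightarrow> \<eta> (Cod C f) \<cdot>\<^bsub>C\<^esub> f = amap G (amap F f) \<cdot>\<^bsub>C\<^esub> \<eta> (Dom C f)"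
  using unit.naturality_Arr[of f] by simp

lemma counit_natural:
  "h \<in> Arr D \<Longrightarrow> \<epsilon> (Cod D h) \<cdot>\<^bsub>D\<^esub> amap F (amap G h) = h \<cdot>\<^bsub>D\<^esub> \<epsilon> (Dom D h)"
  using counit.naturality_Arr[of h] by simp

lemma IGF_functor: "is_functor C X (I \<circ>\<^sub>F G \<circ>\<^sub>F F)"
  by (intro is_functor_comp) unfold_locales

text \<open>By (a) and (b), \<open>P\<close> turns a composite of counits and arrows
  \<open>amap F f\<close> into the composite of the matching \<gamma> and \<open>amap I f\<close>.
  Each law of \<gamma> is thus the image of an equation about \<epsilon> in
  \<open>D\<close>.\<close>

lemma separable_imp_retraction:
  assumes "heavily_separable C D X F I"
  shows "\<exists>\<gamma>. nat_trans C X (I \<circ>\<^sub>F G \<circ>\<^sub>F F) I \<gamma> \<and>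
             nt_eq C (nt_comp X \<gamma> (I \<rhd> \<eta>)) (nt_id X I) \<and>
             nt_eq C (nt_comp X \<gamma> (\<gamma> \<lhd> (G \<circ>\<^sub>F F)))
                     (nt_comp X \<gamma> ((I \<circ>\<^sub>F G) \<rhd> (\<epsilon> \<lhd> F)))"
proof -
  obtain P where "hom_nat_trans C D X F I P"
    and P_amap: "\<And>a b f. a \<in> Obj C \<Longrightarrow> b \<in> Obj C \<Longrightarrow> f \<in> Hom C a b \<Longrightarrow> P a b (amap F f) = amap I f"
    and P_Comp: "\<And>a b c f g. a \<in> Obj C \<Longrightarrow> b \<in> Obj C \<Longrightarrow> c \<in> Obj C \<Longrightarrow>
          f \<in> Hom D (omap F a) (omap F b) \<Longrightarrow> g \<in> Hom D (omap F b) (omap F c) \<Longrightarrow>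
          P a c (g \<cdot>\<^bsub>D\<^esub> f) = P b c g \<cdot>\<^bsub>X\<^esub> P a b f"
    using assms unfolding heavily_separable_def by blast
  interpret P: hom_nat_trans C D X F I P by fact
  define \<gamma> where "\<gamma> a = P (omap G (omap F a)) a (\<epsilon> (omap F a))" for a
  \<comment> \<open>By (a) the factor \<open>amap I f\<close> is itself a value of \<open>P\<close>,
    so (b) merges the composite into one value of \<open>P\<close>. The middle object is invisible
    in the merged arrow and has to be supplied.\<close>
  have \<gamma>_Comp: "\<gamma> b \<cdot>\<^bsub>X\<^esub> amap I f = P a b (\<epsilon> (omap F b) \<cdot>\<^bsub>D\<^esub> amap F f)"
    if "b \<in> Obj C" "f \<in> Hom C a (omap G (omap F b))" for a b f
  proof -
    have "a \<in> Obj C"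
      using that(2) left.dom.Dom_Obj by (auto simp: Hom_def)
    then show ?thesis
      unfolding \<gamma>_def using that
      by (subst P_Comp[where b = "omap G (omap F b)"]) (auto simp: Hom_def P_amap)
  qed
  have Comp_\<gamma>: "amap I f \<cdot>\<^bsub>X\<^esub> \<gamma> a = P (omap G (omap F a)) b (amap F f \<cdot>\<^bsub>D\<^esub> \<epsilon> (omap F a))"
    if "f \<in> Hom C a b" for a b f
  proof -
    have "a \<in> Obj C" "b \<in> Obj C"
      using that left.dom.Dom_Obj left.dom.Cod_Obj by (auto simp: Hom_def)
    then show ?thesis
      unfolding \<gamma>_def using that
      by (subst P_Comp[where b = a]) (auto simp: Hom_def P_amap)
  qed
  have "nat_trans C X (I \<circ>\<^sub>F G \<circ>\<^sub>F F) I \<gamma>"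
  proof (intro nat_trans.intro IGF_functor test.is_functor_axioms nat_trans_axioms.intro)
    fix a assume "a \<in> Obj C"
    then show "\<gamma> a \<in> Hom X (omap (I \<circ>\<^sub>F G \<circ>\<^sub>F F) a) (omap I a)"
      using P.component_fun[of "omap G (omap F a)" a "\<epsilon> (omap F a)"]
      by (simp add: \<gamma>_def Hom_def)
  next
    fix f a b assume f: "f \<in> Hom C a b"
    then have "f \<in> Arr C" "b \<in> Obj C" "Dom C f = a" "Cod C f = b"
      using left.dom.Cod_Obj by (auto simp: Hom_def)
    \<comment> \<open>The two sides are the values of \<open>P\<close> at the two sides of the
      naturality square of \<epsilon> for \<open>amap F f\<close>.\<close>
    then show "\<gamma> b \<cdot>\<^bsub>X\<^esub> amap (I \<circ>\<^sub>F G \<circ>\<^sub>F F) f = amap I f \<cdot>\<^bsub>X\<^esub> \<gamma> a"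
      using counit_natural[of "amap F f"] \<gamma>_Comp[of b "amap G (amap F f)" "omap G (omap F a)"]
        Comp_\<gamma>[OF f] by (simp add: Hom_def)
  qed
  moreover have "nt_eq C (nt_comp X \<gamma> (I \<rhd> \<eta>)) (nt_id X I)"
    unfolding nt_simps
  proof
    fix a assume "a \<in> Obj C"
    \<comment> \<open>The triangle identity reduces the argument of \<open>P\<close> to the
      identity, which is \<open>F\<close> of an identity, so (a) evaluates it.\<close>
    then show "\<gamma> a \<cdot>\<^bsub>X\<^esub> amap I (\<eta> a) = Ident X (omap I a)"
      using \<gamma>_Comp[of a "\<eta> a" a] P_amap[of a a "Ident C a"]
      by (simp add: Hom_def triangle_left_at)
  qed
  moreover have "nt_eq C (nt_comp X \<gamma> (\<gamma> \<lhd> (G \<circ>\<^sub>F F))) (nt_comp X \<gamma> ((I \<circ>\<^sub>F G) \<rhd> (\<epsilon> \<lhd> F)))"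
    unfolding nt_simps
  proof
    fix a assume a: "a \<in> Obj C"
    let ?b = "omap G (omap F a)"
    have "\<gamma> a \<cdot>\<^bsub>X\<^esub> \<gamma> ?b = P (omap G (omap F ?b)) a (\<epsilon> (omap F a) \<cdot>\<^bsub>D\<^esub> \<epsilon> (omap F ?b))"
      unfolding \<gamma>_def using a by (subst P_Comp[where b = ?b]) (auto simp: Hom_def)
    \<comment> \<open>Naturality of \<epsilon> at the arrow \<open>\<epsilon> (omap F a)\<close>
      itself turns the inner counit into an arrow in the image of \<open>F\<close>, to which
      \<open>\<gamma>_Comp\<close> applies.\<close>
    also have "\<dots> = \<gamma> a \<cdot>\<^bsub>X\<^esub> amap I (amap G (\<epsilon> (omap F a)))"
      using a counit_natural[of "\<epsilon> (omap F a)"] by (subst \<gamma>_Comp) (auto simp: Hom_def)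
    finally show "\<gamma> a \<cdot>\<^bsub>X\<^esub> \<gamma> (omap (G \<circ>\<^sub>F F) a)
        = \<gamma> a \<cdot>\<^bsub>X\<^esub> amap (I \<circ>\<^sub>F G) (\<epsilon> (omap F a))" by simp
  qed
  ultimately show ?thesis by blast
qed

text \<open>Naturality of \<eta> and \<gamma> makes the family \<open>P\<close> natural, the unit
  law gives (a), and the associativity law lets two occurrences of \<gamma> merge into one, which
  gives (b).\<close>

lemma retraction_imp_separable:
  assumes "nat_trans C X (I \<circ>\<^sub>F G \<circ>\<^sub>F F) I \<gamma>"
    and "nt_eq C (nt_comp X \<gamma> (I \<rhd> \<eta>)) (nt_id X I)"
    and "nt_eq C (nt_comp X \<gamma> (\<gamma> \<lhd> (G \<circ>\<^sub>F F))) (nt_comp X \<gamma> ((I \<circ>\<^sub>F G) \<rhd> (\<epsilon> \<lhd> F)))"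
  shows "heavily_separable C D X F I"
proof -
  interpret \<gamma>: nat_trans C X "I \<circ>\<^sub>F G \<circ>\<^sub>F F" I \<gamma> by fact
  have \<gamma>_simps [simp]: "\<gamma> a \<in> Arr X" "Dom X (\<gamma> a) = omap I (omap G (omap F a))"
    "Cod X (\<gamma> a) = omap I a" if "a \<in> Obj C" for a
    using \<gamma>.component_simps[OF that] by simp_all
  have \<gamma>_natural: "\<gamma> (Cod C f) \<cdot>\<^bsub>X\<^esub> amap I (amap G (amap F f)) = amap I f \<cdot>\<^bsub>X\<^esub> \<gamma> (Dom C f)"
    if "f \<in> Arr C" for f
    using \<gamma>.naturality_Arr[OF that] by simp
  have \<gamma>_unit: "\<gamma> a \<cdot>\<^bsub>X\<^esub> amap I (\<eta> a) = Ident X (omap I a)" if "a \<in> Obj C" for a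
    using assms(2) that by (simp add: nt_simps)
  have \<gamma>_assoc: "\<gamma> a \<cdot>\<^bsub>X\<^esub> \<gamma> (omap G (omap F a)) = \<gamma> a \<cdot>\<^bsub>X\<^esub> amap I (amap G (\<epsilon> (omap F a)))"
    if "a \<in> Obj C" for a
    using assms(3) that by (simp add: nt_simps)
  \<comment> \<open>The adjunct of \<open>h\<close> is \<open>amap G h\<close> after
    \<open>\<eta> a\<close>, an arrow from \<open>a\<close> to \<open>GFb\<close>; \<open>I\<close>
    carries it to \<open>X\<close>, and \<open>\<gamma> b\<close> brings its codomain back to
    \<open>Ib\<close>.\<close>
  define P where "P a b h = \<gamma> b \<cdot>\<^bsub>X\<^esub> (amap I (amap G h) \<cdot>\<^bsub>X\<^esub> amap I (\<eta> a))" for a b h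
  have "hom_nat_trans C D X F I P"
  proof (intro hom_nat_trans.intro left.is_functor_axioms test.is_functor_axioms
      hom_nat_trans_axioms.intro)
    fix a b h assume "a \<in> Obj C" "b \<in> Obj C" "h \<in> Hom D (omap F a) (omap F b)"
    then show "P a b h \<in> Hom X (omap I a) (omap I b)"
      by (auto simp: P_def Hom_def)
  next
    fix u v h a a' b b'
    assume u: "u \<in> Hom C a' a" and v: "v \<in> Hom C b b'" and h: "h \<in> Hom D (omap F a) (omap F b)"
    have obj: "a \<in> Obj C" "a' \<in> Obj C" "b \<in> Obj C" "b' \<in> Obj C"
      using u v left.dom.Dom_Obj left.dom.Cod_Obj by (auto simp: Hom_def)
    note [simp] = u[unfolded Hom_def, simplified] v[unfolded Hom_def, simplified]
      h[unfolded Hom_def, simplified] obj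
    let ?Iu = "amap I u" and ?Iv = "amap I v" and ?IGh = "amap I (amap G h)"
    \<comment> \<open>Naturality of \<eta> moves \<open>u\<close> out at the right end and
      naturality of \<gamma> moves \<open>v\<close> out at the left end. Only the latter needs a
      tail \<open>k\<close>, as composites nest to the right.\<close>
    have "amap I (amap G (amap F u)) \<cdot>\<^bsub>X\<^esub> amap I (\<eta> a') = amap I (\<eta> a) \<cdot>\<^bsub>X\<^esub> ?Iu"
      using arg_cong[OF unit_natural[of u], of "amap I"] by simp
    moreover have "\<gamma> b' \<cdot>\<^bsub>X\<^esub> (amap I (amap G (amap F v)) \<cdot>\<^bsub>X\<^esub> k) = ?Iv \<cdot>\<^bsub>X\<^esub> (\<gamma> b \<cdot>\<^bsub>X\<^esub> k)"
      if "k \<in> Arr X" "Cod X k = omap I (omap G (omap F b))" for k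
      using \<gamma>_natural[of v] that by (intro test.cod.Comp_eq_extend) auto
    ultimately show "P a' b' (hom_map D (amap F u) (amap F v) h) = hom_map X ?Iu ?Iv (P a b h)"
      by (simp add: P_def hom_map_def)
  qed
  moreover have "P a b (amap F f) = amap I f" if "f \<in> Hom C a b" for a b f
  proof -
    have [simp]: "f \<in> Arr C" "Dom C f = a" "Cod C f = b" "a \<in> Obj C" "b \<in> Obj C"
      using that left.dom.Dom_Obj left.dom.Cod_Obj by (auto simp: Hom_def)
    \<comment> \<open>Naturality of \<gamma> pulls \<open>f\<close> to the front and leaves the unit
      law at \<open>a\<close>.\<close>
    have "P a b (amap F f) = amap I f \<cdot>\<^bsub>X\<^esub> (\<gamma> a \<cdot>\<^bsub>X\<^esub> amap I (\<eta> a))"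
      unfolding P_def using \<gamma>_natural[of f] by (intro test.cod.Comp_eq_extend) auto
    then show ?thesis by (simp add: \<gamma>_unit)
  qed
  moreover have "P a c (g \<cdot>\<^bsub>D\<^esub> f) = P b c g \<cdot>\<^bsub>X\<^esub> P a b f"
    if "a \<in> Obj C" "b \<in> Obj C" "c \<in> Obj C"
      and f: "f \<in> Hom D (omap F a) (omap F b)" and g: "g \<in> Hom D (omap F b) (omap F c)" for a b c f g
  proof -
    note [simp] = that(1-3) f[unfolded Hom_def, simplified] g[unfolded Hom_def, simplified]
    let ?IG = "\<lambda>h. amap I (amap G h)"
    let ?r = "?IG f \<cdot>\<^bsub>X\<^esub> amap I (\<eta> a)"
    \<comment> \<open>The inner \<gamma> is moved left, past \<open>\<eta> b\<close> and then past
      \<open>amap G g\<close>, by naturality at these two arrows. It ends up as \<gamma> at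
      \<open>GFc\<close>, next to \<open>\<gamma> c\<close>; the tail \<open>?r\<close>, the image
      of the adjunct of \<open>f\<close>, stays fixed.\<close>
    have "P b c g \<cdot>\<^bsub>X\<^esub> P a b f = \<gamma> c \<cdot>\<^bsub>X\<^esub> (?IG g \<cdot>\<^bsub>X\<^esub> (amap I (\<eta> b) \<cdot>\<^bsub>X\<^esub> (\<gamma> b \<cdot>\<^bsub>X\<^esub> ?r)))"
      by (simp add: P_def)
    also have "amap I (\<eta> b) \<cdot>\<^bsub>X\<^esub> (\<gamma> b \<cdot>\<^bsub>X\<^esub> ?r)
        = \<gamma> (omap G (omap F b)) \<cdot>\<^bsub>X\<^esub> (?IG (amap F (\<eta> b)) \<cdot>\<^bsub>X\<^esub> ?r)"
      using \<gamma>_natural[of "\<eta> b"] by (intro test.cod.Comp_eq_extend) auto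
    also have "?IG g \<cdot>\<^bsub>X\<^esub> (\<gamma> (omap G (omap F b)) \<cdot>\<^bsub>X\<^esub> (?IG (amap F (\<eta> b)) \<cdot>\<^bsub>X\<^esub> ?r))
        = \<gamma> (omap G (omap F c)) \<cdot>\<^bsub>X\<^esub> (?IG (amap F (amap G g)) \<cdot>\<^bsub>X\<^esub> (?IG (amap F (\<eta> b)) \<cdot>\<^bsub>X\<^esub> ?r))"
      using \<gamma>_natural[of "amap G g"] by (intro test.cod.Comp_eq_extend) auto
    \<comment> \<open>The associativity law trades the second \<gamma> for the image of a
      counit.\<close>
    also have "\<gamma> c \<cdot>\<^bsub>X\<^esub> \<dots>
        = \<gamma> c \<cdot>\<^bsub>X\<^esub> (?IG (\<epsilon> (omap F c)) \<cdot>\<^bsub>X\<^esub>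
            (?IG (amap F (amap G g)) \<cdot>\<^bsub>X\<^esub> (?IG (amap F (\<eta> b)) \<cdot>\<^bsub>X\<^esub> ?r)))"
      using \<gamma>_assoc[of c] by (intro test.cod.Comp_eq_extend) auto
    also have "?IG (\<epsilon> (omap F c)) \<cdot>\<^bsub>X\<^esub>
            (?IG (amap F (amap G g)) \<cdot>\<^bsub>X\<^esub> (?IG (amap F (\<eta> b)) \<cdot>\<^bsub>X\<^esub> ?r))
        = ?IG ((\<epsilon> (omap F c) \<cdot>\<^bsub>D\<^esub> amap F (amap G g)) \<cdot>\<^bsub>D\<^esub> amap F (\<eta> b)) \<cdot>\<^bsub>X\<^esub> ?r"
      by simp
    \<comment> \<open>What remains under \<open>IG\<close> is the adjunct of \<open>g\<close>
      transposed back: naturality of \<epsilon> brings \<open>g\<close> to the front, and the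
      triangle identity at \<open>b\<close> removes the rest.\<close>
    also have "(\<epsilon> (omap F c) \<cdot>\<^bsub>D\<^esub> amap F (amap G g)) \<cdot>\<^bsub>D\<^esub> amap F (\<eta> b) = g"
      using counit_natural[of g] triangle_left_at[of b] by simp
    also have "\<gamma> c \<cdot>\<^bsub>X\<^esub> (?IG g \<cdot>\<^bsub>X\<^esub> ?r) = P a c (g \<cdot>\<^bsub>D\<^esub> f)"
      by (simp add: P_def)
    finally show ?thesis ..
  qed
  ultimately show ?thesis
    unfolding heavily_separable_def by blast
qed

lemma left_adjoint_heavily_separable_iff:
  "heavily_separable C D X F I \<longleftrightarrow>
    (\<exists>\<gamma>. nat_trans C X (I \<circ>\<^sub>F G \<circ>\<^sub>F F) I \<gamma> \<and>
      nt_eq C (nt_comp X \<gamma> (I \<rhd> \<eta>)) (nt_id X I) \<and>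
      nt_eq C (nt_comp X \<gamma> (\<gamma> \<lhd> (G \<circ>\<^sub>F F))) (nt_comp X \<gamma> ((I \<circ>\<^sub>F G) \<rhd> (\<epsilon> \<lhd> F))))"
  using separable_imp_retraction retraction_imp_separable by blast

end

section \<open>Duality: passage to opposite categories\<close>

definition opposite :: "('o, 'm) category \<Rightarrow> ('o, 'm) category" where
  "opposite C = \<lparr>Obj = Obj C, Arr = Arr C, Dom = Cod C, Cod = Dom C, Ident = Ident C,
     Comp = (\<lambda>g f. f \<cdot>\<^bsub>C\<^esub> g)\<rparr>"

text \<open>Objects and arrows keep their types, so functors and component families serve unchanged
  over the opposites. The involution is an equality of records, so each implication below gives its
  converse when applied to the opposites.\<close>

lemma opposite_simps [simp]:
  "Obj (opposite C) = Obj C" "Arr (opposite C) = Arr C"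
  "Dom (opposite C) = Cod C" "Cod (opposite C) = Dom C"
  "Ident (opposite C) = Ident C" "g \<cdot>\<^bsub>opposite C\<^esub> f = f \<cdot>\<^bsub>C\<^esub> g"
  "Hom (opposite C) a b = Hom C b a" "opposite (opposite C) = C"
  by (auto simp: opposite_def Hom_def)

text \<open>Only the order of composition changes. Whiskerings do not refer to a category and need
  no rule.\<close>

lemma nt_opposite [simp]:
  "nt_eq (opposite C) = nt_eq C" "nt_id (opposite C) F = nt_id C F"
  "nt_comp (opposite C) \<sigma> \<tau> = nt_comp C \<tau> \<sigma>"
  by (auto simp: nt_eq_def nt_id_def nt_comp_def fun_eq_iff)

lemma category_opposite:
  assumes "category C"
  shows "category (opposite C)"
proof -
  interpret category C by fact
  show ?thesis
    by unfold_locales (auto simp: Hom_def)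
qed

lemma is_functor_opposite:
  assumes "is_functor C D F"
  shows "is_functor (opposite C) (opposite D) F"
proof -
  interpret is_functor C D F by fact
  show ?thesis
    by (intro is_functor.intro category_opposite is_functor_axioms.intro)
      (unfold_locales, auto simp: Hom_def)
qed

lemma nat_trans_opposite:
  assumes "nat_trans C D F G \<tau>"
  shows "nat_trans (opposite C) (opposite D) G F \<tau>"
proof -
  interpret nat_trans C D F G \<tau> by fact
  show ?thesis
    by (intro nat_trans.intro is_functor_opposite nat_trans_axioms.intro)
      (unfold_locales, auto simp: component_Hom naturality)
qed

lemma nat_trans_opposite_iff:
  "nat_trans (opposite C) (opposite D) G F \<tau> \<longleftrightarrow> nat_trans C D F G \<tau>"
  using nat_trans_opposite[of C D F G \<tau>] nat_trans_opposite[of "opposite C" "opposite D" G F \<tau>]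
  by auto

text \<open>Reversing arrows exchanges the adjoints, the unit with the counit, and the two triangle
  identities.\<close>

lemma adjunction_opposite:
  assumes "adjunction C D F G \<eta> \<epsilon>"
  shows "adjunction (opposite D) (opposite C) G F \<epsilon> \<eta>"
proof -
  interpret adjunction C D F G \<eta> \<epsilon> by fact
  show ?thesis
    by (intro adjunction.intro is_functor_opposite nat_trans_opposite adjunction_axioms.intro)
      (unfold_locales, use triangle_left triangle_right in auto)
qed

lemma hom_nat_trans_opposite:
  assumes "hom_nat_trans C D X F I P"
  shows "hom_nat_trans (opposite C) (opposite D) (opposite X) F I (\<lambda>a b. P b a)"
proof -
  interpret hom_nat_trans C D X F I P by fact
  show ?thesis
  proof (intro hom_nat_trans.intro is_functor_opposite hom_nat_trans_axioms.intro
      first.is_functor_axioms second.is_functor_axioms)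
    fix u v h a a' b b'
    assume u: "u \<in> Hom (opposite C) a' a" and v: "v \<in> Hom (opposite C) b b'"
      and h: "h \<in> Hom (opposite D) (omap F a) (omap F b)"
    \<comment> \<open>In the opposite category \<open>hom_map\<close> brackets the same three
      factors the other way. Rebracketing in \<open>X\<close> requires the type of this middle
      factor.\<close>
    have "P b a h \<in> Hom X (omap I b) (omap I a)"
      using u v h by (intro component_fun) (auto simp: Hom_def)
    then show "P b' a' (hom_map (opposite D) (amap F u) (amap F v) h)
        = hom_map (opposite X) (amap I u) (amap I v) (P b a h)"
      using u v h hom_naturality[of v b' b u a a' h] by (auto simp: hom_map_def Hom_def)
  qed (auto simp: component_fun)
qed

text \<open>The notion is self-dual: with the object indices of \<open>P\<close> swapped, reversing
  composition in \<open>D\<close> and \<open>X\<close> together turns (b) into itself with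
  \<open>f\<close> and \<open>g\<close> exchanged.\<close>

lemma heavily_separable_opposite:
  assumes "heavily_separable C D X F I"
  shows "heavily_separable (opposite C) (opposite D) (opposite X) F I"
proof -
  obtain P where P: "hom_nat_trans C D X F I P"
      "\<forall>a \<in> Obj C. \<forall>b \<in> Obj C. \<forall>f \<in> Hom C a b. P a b (amap F f) = amap I f"
      "\<forall>a \<in> Obj C. \<forall>b \<in> Obj C. \<forall>c \<in> Obj C.
        \<forall>f \<in> Hom D (omap F a) (omap F b). \<forall>g \<in> Hom D (omap F b) (omap F c).
          P a c (g \<cdot>\<^bsub>D\<^esub> f) = P b c g \<cdot>\<^bsub>X\<^esub> P a b f"
    using assms unfolding heavily_separable_def by blast
  show ?thesis
    unfolding heavily_separable_def
    by (rule exI[of _ "\<lambda>a b. P b a"]) (use P hom_nat_trans_opposite[OF P(1)] in simp)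
qed

lemma heavily_separable_opposite_iff:
  "heavily_separable (opposite C) (opposite D) (opposite X) F I \<longleftrightarrow> heavily_separable C D X F I"
  using heavily_separable_opposite[of C D X F I]
    heavily_separable_opposite[of "opposite C" "opposite D" "opposite X" F I] by auto

theorem theorem2p3:
  fixes C :: "('oc, 'mc) category" and D :: "('od, 'md) category"
    and X :: "('ox, 'mx) category" and Y :: "('oy, 'my) category"
    and F :: "('oc, 'mc, 'od, 'md) fctor" and G :: "('od, 'md, 'oc, 'mc) fctor"
    and \<eta> :: "'oc \<Rightarrow> 'mc" and \<epsilon> :: "'od \<Rightarrow> 'md"
    and I :: "('oc, 'mc, 'ox, 'mx) fctor" and J :: "('od, 'md, 'oy, 'my) fctor"
  assumes "adjunction C D F G \<eta> \<epsilon>"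
    and "is_functor C X I"
    and "is_functor D Y J"
  shows "(heavily_separable C D X F I \<longleftrightarrow>
           (\<exists>\<gamma>. nat_trans C X (I \<circ>\<^sub>F G \<circ>\<^sub>F F) I \<gamma> \<and>
             nt_eq C (nt_comp X \<gamma> (I \<rhd> \<eta>)) (nt_id X I) \<and>
             nt_eq C (nt_comp X \<gamma> (\<gamma> \<lhd> (G \<circ>\<^sub>F F)))
                     (nt_comp X \<gamma> ((I \<circ>\<^sub>F G) \<rhd> (\<epsilon> \<lhd> F))))) \<and>
         (heavily_separable D C Y G J \<longleftrightarrow>
           (\<exists>\<delta>. nat_trans D Y J (J \<circ>\<^sub>F F \<circ>\<^sub>F G) \<delta> \<and>
             nt_eq D (nt_comp Y (J \<rhd> \<epsilon>) \<delta>) (nt_id Y J) \<and>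
             nt_eq D (nt_comp Y (\<delta> \<lhd> (F \<circ>\<^sub>F G)) \<delta>)
                     (nt_comp Y ((J \<circ>\<^sub>F F) \<rhd> (\<eta> \<lhd> G)) \<delta>)))"
proof (intro conjI)
  interpret left: adjunction_with_functor C D F G \<eta> \<epsilon> X I
    using assms by (simp add: adjunction_with_functor_def)
  \<comment> \<open>Over the opposites \<open>G\<close> is the left adjoint, with unit \<epsilon>
    and counit \<eta>, and \<open>J\<close> takes the place of \<open>I\<close>.\<close>
  interpret right: adjunction_with_functor "opposite D" "opposite C" G F \<epsilon> \<eta> "opposite Y" J
    using assms by (simp add: adjunction_with_functor_def adjunction_opposite is_functor_opposite)
  show "heavily_separable C D X F I \<longleftrightarrow>
           (\<exists>\<gamma>. nat_trans C X (I \<circ>\<^sub>F G \<circ>\<^sub>F F) I \<gamma> \<and>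
             nt_eq C (nt_comp X \<gamma> (I \<rhd> \<eta>)) (nt_id X I) \<and>
             nt_eq C (nt_comp X \<gamma> (\<gamma> \<lhd> (G \<circ>\<^sub>F F)))
                     (nt_comp X \<gamma> ((I \<circ>\<^sub>F G) \<rhd> (\<epsilon> \<lhd> F))))"
    by (rule left.left_adjoint_heavily_separable_iff)
  show "heavily_separable D C Y G J \<longleftrightarrow>
           (\<exists>\<delta>. nat_trans D Y J (J \<circ>\<^sub>F F \<circ>\<^sub>F G) \<delta> \<and>
             nt_eq D (nt_comp Y (J \<rhd> \<epsilon>) \<delta>) (nt_id Y J) \<and>
             nt_eq D (nt_comp Y (\<delta> \<lhd> (F \<circ>\<^sub>F G)) \<delta>)
                     (nt_comp Y ((J \<circ>\<^sub>F F) \<rhd> (\<eta> \<lhd> G)) \<delta>))"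
    \<comment> \<open>A transformation \<gamma> from \<open>JFG\<close> to \<open>J\<close> over the
      opposites is a \<delta> from \<open>J\<close> to \<open>JFG\<close>; reversing each
      \<open>nt_comp\<close> turns the laws of \<gamma> into those of \<delta>.\<close>
    using right.left_adjoint_heavily_separable_iff
    unfolding heavily_separable_opposite_iff nat_trans_opposite_iff nt_opposite .
qed

end
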